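(* Let $\mathsf{A}\in\mathbb{R}^{J_1\times J_1\times\cdots\times J_N\times J_N}$ and $\mathsf{B}\in\mathbb{R}^{J_1\times K_1\times\cdots\times J_N\times K_N}$. The pair $(\mathsf{A},\mathsf{B})$ is reachable on $[t_0,t_1]$ if and only if the reachability Gramian $$\mathsf{W}_r(t_0,t_1)=\sum_{t=t_0}^{t_1-1}\mathsf{A}^{t_1-t-1}*\mathsf{B}*\mathsf{B}^\top*(\mathsf{A}^\top)^{t_1-t-1},$$ which is a weakly symmetric even-order square tensor, is U-positive definite.
   Context: Einstein products: for an $N$-th order tensor $\mathsf{X}$, $(\mathsf{A}*\mathsf{X})_{j_1\cdots j_N}=\sum_{i_1,\dots,i_N}\mathsf{A}_{j_1i_1\cdots j_Ni_N}\mathsf{X}_{i_1\cdots i_N}$; for even-order paired tensors $\mathsf{M}\in\mathbb{R}^{P_1\times Q_1\times\cdots\times P_N\times Q_N}$ and $\mathsf{L}\in\mathbb{R}^{Q_1\times S_1\times\cdots\times Q_N\times S_N}$, $(\mathsf{M}*\mathsf{L})_{p_1s_1\cdots p_Ns_N}=\sum_{q_1,\dots,q_N}\mathsf{M}_{p_1q_1\cdots p_Nq_N}\mathsf{L}_{q_1s_1\cdots q_Ns_N}$. $\mathsf{A}^k$ is the $k$-fold Einstein product of $\mathsf{A}$ with itself and $\mathsf{A}^0=\mathsf{I}$, the identity tensor for $*$. The U-transpose $\mathsf{M}^\top$ is given by $(\mathsf{M}^\top)_{q_1p_1\cdots q_Np_N}=\mathsf{M}_{p_1q_1\cdots p_Nq_N}$;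 $\mathsf{M}$ is weakly symmetric if $\mathsf{M}^\top=\mathsf{M}$. An even-order square tensor $\mathsf{W}\in\mathbb{R}^{J_1\times J_1\times\cdots\times J_N\times J_N}$ is U-positive definite if $\mathsf{X}^\top*\mathsf{W}*\mathsf{X}>0$, i.e. $\sum_{\mathbf{j},\mathbf{i}}\mathsf{X}_{j_1\cdots j_N}\mathsf{W}_{j_1i_1\cdots j_Ni_N}\mathsf{X}_{i_1\cdots i_N}>0$, for every nonzero $\mathsf{X}\in\mathbb{R}^{J_1\times\cdots\times J_N}$. The pair $(\mathsf{A},\mathsf{B})$ is reachable on $[t_0,t_1]$ ($t_0<t_1$ integers) if for any $\mathsf{X}_0,\mathsf{X}_1\in\mathbb{R}^{J_1\times\cdots\times J_N}$ there is a sequence of inputs $\mathsf{U}_t\in\mathbb{R}^{K_1\times\cdots\times K_N}$ that steers the state of the system $\mathsf{X}_{t+1}=\mathsf{A}*\mathsf{X}_t+\mathsf{B}*\mathsf{U}_t$ from $\mathsf{X}_{t_0}=\mathsf{X}_0$ to $\mathsf{X}_{t_1}=\mathsf{X}_1$. *)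

theory Defs
  imports Complex_Main "HOL-Library.Function_Algebras"
begin

text \<open>
  A tensor of dimensions \<open>ds = [d\<^sub>1, \<dots>, d\<^sub>n]\<close> is a real function of multi-indices
  \<open>[i\<^sub>1, \<dots>, i\<^sub>n]\<close> with \<open>1 \<le> i\<^sub>k \<le> d\<^sub>k\<close>. It is extended by \<open>0\<close> to all other lists, so
  that equality, \<open>0\<close>, \<open>+\<close> and finite sums of tensors are those of the function space.
\<close>

type_synonym tensor = "nat list \<Rightarrow> real"

definition indices :: "nat list \<Rightarrow> nat list set" where
  "indices ds = {is. list_all2 (\<lambda>i d. 1 \<le> i \<and> i \<le> d) is ds}"

definition tensors :: "nat list \<Rightarrow> tensor set" where
  "tensors ds = {X. \<forall>is. is \<notin> indices ds \<longrightarrow> X is = 0}"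

text \<open>
  For lists \<open>P\<close>, \<open>Q\<close> of equal length \<open>n\<close>, \<open>splice P Q = [P\<^sub>1, Q\<^sub>1, \<dots>, P\<^sub>n, Q\<^sub>n]\<close>, so the
  even-order paired tensors of size \<open>P\<^sub>1 \<times> Q\<^sub>1 \<times> \<dots> \<times> P\<^sub>n \<times> Q\<^sub>n\<close> are \<open>tensors (splice P Q)\<close>
  and their entries are \<open>M (splice p q)\<close>. The function below builds the paired tensor whose
  entry at \<open>splice p q\<close> is \<open>f p q\<close>; the two \<open>nths\<close> terms recover \<open>p\<close> and \<open>q\<close>.
\<close>

definition paired :: "nat list \<Rightarrow> nat list \<Rightarrow> (nat list \<Rightarrow> nat list \<Rightarrow> real) \<Rightarrow> tensor" where
  "paired P Q f = (\<lambda>x. if x \<in> indices (splice P Q)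
     then f (nths x {k. even k}) (nths x {k. odd k}) else 0)"

definition einstein_apply :: "nat list \<Rightarrow> nat list \<Rightarrow> tensor \<Rightarrow> tensor \<Rightarrow> tensor" where
  "einstein_apply P Q M X = (\<lambda>p. if p \<in> indices P
     then \<Sum>q\<in>indices Q. M (splice p q) * X q else 0)"

definition einstein_prod ::
    "nat list \<Rightarrow> nat list \<Rightarrow> nat list \<Rightarrow> tensor \<Rightarrow> tensor \<Rightarrow> tensor" where
  "einstein_prod P Q S M L =
     paired P S (\<lambda>p s. \<Sum>q\<in>indices Q. M (splice p q) * L (splice q s))"

definition identity_tensor :: "nat list \<Rightarrow> tensor" where
  "identity_tensor J = paired J J (\<lambda>j i. if j = i then 1 else 0)"

primrec einstein_power :: "nat list \<Rightarrow> tensor \<Rightarrow> nat \<Rightarrow> tensor" where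
  "einstein_power J A 0 = identity_tensor J"
| "einstein_power J A (Suc k) = einstein_prod J J J A (einstein_power J A k)"

text \<open>\<open>u_transpose P Q\<close> maps \<open>tensors (splice P Q)\<close> to \<open>tensors (splice Q P)\<close>.\<close>

definition u_transpose :: "nat list \<Rightarrow> nat list \<Rightarrow> tensor \<Rightarrow> tensor" where
  "u_transpose P Q M = paired Q P (\<lambda>q p. M (splice p q))"

definition weakly_symmetric :: "nat list \<Rightarrow> tensor \<Rightarrow> bool" where
  "weakly_symmetric J M \<longleftrightarrow> u_transpose J J M = M"

definition u_positive_definite :: "nat list \<Rightarrow> tensor \<Rightarrow> bool" where
  "u_positive_definite J W \<longleftrightarrow> (\<forall>X\<in>tensors J. X \<noteq> 0 \<longrightarrow>
     (\<Sum>j\<in>indices J. \<Sum>i\<in>indices J. X j * W (splice j i) * X i) > 0)"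

definition reachable ::
    "nat list \<Rightarrow> nat list \<Rightarrow> tensor \<Rightarrow> tensor \<Rightarrow> int \<Rightarrow> int \<Rightarrow> bool" where
  "reachable J K A B t0 t1 \<longleftrightarrow> (\<forall>X0\<in>tensors J. \<forall>X1\<in>tensors J.
     \<exists>U X :: int \<Rightarrow> tensor.
       (\<forall>t\<in>{t0..<t1}. U t \<in> tensors K) \<and>
       X t0 = X0 \<and>
       (\<forall>t\<in>{t0..<t1}. X (t + 1) = einstein_apply J J A (X t) + einstein_apply J K B (U t)) \<and>
       X t1 = X1)"

definition reachability_gramian ::
    "nat list \<Rightarrow> nat list \<Rightarrow> tensor \<Rightarrow> tensor \<Rightarrow> int \<Rightarrow> int \<Rightarrow> tensor" where
  "reachability_gramian J K A B t0 t1 = (\<Sum>t\<in>{t0..t1 - 1}.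
     einstein_prod J J J
       (einstein_prod J K J
         (einstein_prod J J K (einstein_power J A (nat (t1 - t - 1))) B)
         (u_transpose J K B))
       (einstein_power J (u_transpose J J A) (nat (t1 - t - 1))))"

lemma nths_splice:
  assumes "length p = length q"
  shows "nths (splice p q) {k. even k} = p" "nths (splice p q) {k. odd k} = q"
  using assms by (induction p q rule: list_induct2) (simp_all add: nths_Cons)

lemma splice_mem_indices:
  assumes "length P = length Q" "p \<in> indices P" "q \<in> indices Q"
  shows "splice p q \<in> indices (splice P Q)"
proof -
  have "length p = length P" "length q = length Q"
    using assms by (auto simp: indices_def dest: list_all2_lengthD)
  then have "length p = length q" "length q = length P" "length P = length Q"
    using assms(1) by simp_all
  then show ?thesis
    using assms(2,3) unfolding indices_def
    by (induction p q P Q rule: list_induct4) auto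
qed

lemma paired_splice:
  assumes "length P = length Q" "p \<in> indices P" "q \<in> indices Q"
  shows "paired P Q f (splice p q) = f p q"
proof -
  have "length p = length q"
    using assms by (auto simp: indices_def dest!: list_all2_lengthD)
  then show ?thesis
    using splice_mem_indices[OF assms] by (simp add: paired_def nths_splice)
qed

lemma paired_mem_tensors: "paired P Q f \<in> tensors (splice P Q)"
  by (simp add: paired_def tensors_def)

end

(*
  Write C k = A^k * B. Since (A^T)^k is the transpose of A^k, the Gramian W is the sum of the
  tensors C k * (C k)^T, so it is weakly symmetric and X^T * W * X is the sum of the squared
  norms of (C k)^T * X. The state reached at t1 is A^(t1-t0) * X0 plus the sum of
  C (t1-t-1) * U t. If X \<noteq> 0 has X^T * W * X \<le> 0, every (C k)^T * X vanishes, so X is orthogonal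
  to all states reachable from 0 and X itself is not reachable. Conversely, if W is U-positive
  definite, W * Y = D has a solution for every D, and the inputs U t = (C (t1-t-1))^T * Y
  steer 0 to W * Y = D.
*)

theory Submission
  imports Defs
begin

section \<open>Einstein products\<close>

lemma finite_indices [simp]: "finite (indices ds)"
proof (induction ds)
  case Nil
  show ?case by (simp add: indices_def)
next
  case (Cons d ds)
  have "indices (d # ds) \<subseteq> (\<lambda>(i, is). i # is) ` ({1..d} \<times> indices ds)"
    by (auto simp: indices_def list_all2_Cons2)
  then show ?case by (rule finite_subset) (simp add: Cons)
qed

text \<open>The converse of \<open>splice_mem_indices\<close>: interleaving reaches every
  multi-index of a paired tensor, so its values are determined by the entries at
  \<open>splice p q\<close>. The induction peels off one pair of coordinates at a time.\<close>

lemma indices_spliceE: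
  assumes "length P = length Q" "x \<in> indices (splice P Q)"
  obtains p q where "x = splice p q" "p \<in> indices P" "q \<in> indices Q"
proof -
  have "\<exists>p q. x = splice p q \<and> p \<in> indices P \<and> q \<in> indices Q"
    using assms
  proof (induction P Q arbitrary: x rule: list_induct2)
    case Nil
    then show ?case by (auto simp: indices_def intro!: exI[of _ "[]"])
  next
    case (Cons d P e Q)
    then obtain i j y where x: "x = i # j # y" and ij: "1 \<le> i" "i \<le> d" "1 \<le> j" "j \<le> e"
      and y: "y \<in> indices (splice P Q)"
      by (auto simp: indices_def list_all2_Cons2)
    from Cons.IH[OF y] obtain p q
      where "y = splice p q" "p \<in> indices P" "q \<in> indices Q" by blast
    then show ?case using x ij
      by (intro exI[of _ "i # p"] exI[of _ "j # q"]) (auto simp: indices_def)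
  qed
  with that show thesis by blast
qed

lemma tensor_eqI:
  assumes "M \<in> tensors ds" "L \<in> tensors ds" "\<And>x. x \<in> indices ds \<Longrightarrow> M x = L x"
  shows "M = L"
  using assms by (fastforce simp: tensors_def)

text \<open>Tensors are total functions, so equal entries suffice only because both sides vanish at
  all other lists. The laws for products and transposes below reduce to entrywise identities in this
  way.\<close>

lemma paired_tensor_eqI:
  assumes "length P = length Q" "M \<in> tensors (splice P Q)" "L \<in> tensors (splice P Q)"
    and "\<And>p q. p \<in> indices P \<Longrightarrow> q \<in> indices Q \<Longrightarrow> M (splice p q) = L (splice p q)"
  shows "M = L"
  using assms by (metis tensor_eqI indices_spliceE)

lemma zero_mem_tensors [simp]: "0 \<in> tensors ds"
  by (simp add: tensors_def)

lemma add_mem_tensors: "X \<in> tensors ds \<Longrightarrow> Y \<in> tensors ds \<Longrightarrow> X + Y \<in> tensors ds"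
  by (simp add: tensors_def)

lemma diff_mem_tensors: "X \<in> tensors ds \<Longrightarrow> Y \<in> tensors ds \<Longrightarrow> X - Y \<in> tensors ds"
  by (simp add: tensors_def)

lemma sum_mem_tensors: "(\<And>t. t \<in> T \<Longrightarrow> f t \<in> tensors ds) \<Longrightarrow> sum f T \<in> tensors ds"
  by (induction T rule: infinite_finite_induct) (simp_all add: add_mem_tensors)

lemma sum_tensor_apply: "sum f T x = (\<Sum>t\<in>T. f t x)" for f :: "'a \<Rightarrow> tensor"
  by (induction T rule: infinite_finite_induct) simp_all

lemma einstein_apply_mem_tensors: "einstein_apply P Q M X \<in> tensors P"
  by (simp add: einstein_apply_def tensors_def)

lemma einstein_prod_mem_tensors: "einstein_prod P Q S M L \<in> tensors (splice P S)"
  by (simp add: einstein_prod_def paired_mem_tensors)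

lemma u_transpose_mem_tensors: "u_transpose P Q M \<in> tensors (splice Q P)"
  by (simp add: u_transpose_def paired_mem_tensors)

section \<open>Entrywise formulas and the algebra of Einstein products\<close>

lemma einstein_prod_splice:
  assumes "length P = length S" "p \<in> indices P" "s \<in> indices S"
  shows "einstein_prod P Q S M L (splice p s)
    = (\<Sum>q\<in>indices Q. M (splice p q) * L (splice q s))"
  using assms by (simp add: einstein_prod_def paired_splice)

lemma u_transpose_splice:
  assumes "length P = length Q" "p \<in> indices P" "q \<in> indices Q"
  shows "u_transpose P Q M (splice q p) = M (splice p q)"
  using assms by (simp add: u_transpose_def paired_splice)

lemma identity_tensor_splice:
  assumes "p \<in> indices J" "q \<in> indices J"
  shows "identity_tensor J (splice p q) = (if p = q then 1 else 0)"
  using assms by (simp add: identity_tensor_def paired_splice)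

lemma einstein_prod_assoc:
  assumes "length P = length Q" "length Q = length R" "length R = length S"
  shows "einstein_prod P R S (einstein_prod P Q R M L) H
    = einstein_prod P Q S M (einstein_prod Q R S L H)"
proof (rule paired_tensor_eqI[OF _ einstein_prod_mem_tensors einstein_prod_mem_tensors])
  show "length P = length S" using assms by simp
next
  fix p s assume ps: "p \<in> indices P" "s \<in> indices S"
  have "einstein_prod P R S (einstein_prod P Q R M L) H (splice p s)
      = (\<Sum>r\<in>indices R. \<Sum>q\<in>indices Q. M (splice p q) * L (splice q r) * H (splice r s))"
    using assms ps by (simp add: einstein_prod_splice sum_distrib_right)
  also have "\<dots> = (\<Sum>q\<in>indices Q. \<Sum>r\<in>indices R. M (splice p q) * L (splice q r) * H (splice r s))"
    by (rule sum.swap)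
  also have "\<dots> = einstein_prod P Q S M (einstein_prod Q R S L H) (splice p s)"
    using assms ps by (simp add: einstein_prod_splice sum_distrib_left mult.assoc)
  finally show "einstein_prod P R S (einstein_prod P Q R M L) H (splice p s)
    = einstein_prod P Q S M (einstein_prod Q R S L H) (splice p s)" .
qed

lemma einstein_apply_prod:
  assumes "length P = length Q" "length Q = length S"
  shows "einstein_apply P S (einstein_prod P Q S M L) X
    = einstein_apply P Q M (einstein_apply Q S L X)"
proof (rule tensor_eqI[OF einstein_apply_mem_tensors einstein_apply_mem_tensors])
  fix p assume p: "p \<in> indices P"
  have "einstein_apply P S (einstein_prod P Q S M L) X p
      = (\<Sum>s\<in>indices S. \<Sum>q\<in>indices Q. M (splice p q) * L (splice q s) * X s)"
    using assms p by (simp add: einstein_apply_def einstein_prod_splice sum_distrib_right)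
  also have "\<dots> = (\<Sum>q\<in>indices Q. \<Sum>s\<in>indices S. M (splice p q) * L (splice q s) * X s)"
    by (rule sum.swap)
  also have "\<dots> = einstein_apply P Q M (einstein_apply Q S L X) p"
    using p by (simp add: einstein_apply_def sum_distrib_left mult.assoc)
  finally show "einstein_apply P S (einstein_prod P Q S M L) X p
    = einstein_apply P Q M (einstein_apply Q S L X) p" .
qed

lemma einstein_prod_identity_left:
  assumes "length J = length S" "M \<in> tensors (splice J S)"
  shows "einstein_prod J J S (identity_tensor J) M = M"
  by (rule paired_tensor_eqI[OF assms(1) einstein_prod_mem_tensors assms(2)])
    (simp add: assms einstein_prod_splice identity_tensor_splice if_distrib[of "\<lambda>x. x * _"]
      cong: if_cong)

lemma einstein_prod_identity_right:
  assumes "length P = length J" "M \<in> tensors (splice P J)"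
  shows "einstein_prod P J J M (identity_tensor J) = M"
  by (rule paired_tensor_eqI[OF assms(1) einstein_prod_mem_tensors assms(2)])
    (simp add: assms einstein_prod_splice identity_tensor_splice if_distrib[of "\<lambda>x. _ * x"]
      cong: if_cong)

lemma einstein_apply_identity:
  assumes "X \<in> tensors J"
  shows "einstein_apply J J (identity_tensor J) X = X"
  by (rule tensor_eqI[OF einstein_apply_mem_tensors assms])
    (simp add: einstein_apply_def identity_tensor_splice if_distrib[of "\<lambda>x. x * _"] cong: if_cong)

lemma einstein_apply_add:
  "einstein_apply P Q M (X + Y) = einstein_apply P Q M X + einstein_apply P Q M Y"
  by (rule ext) (simp add: einstein_apply_def distrib_left sum.distrib)

lemma einstein_apply_zero [simp]: "einstein_apply P Q M 0 = 0"
  by (rule ext) (simp add: einstein_apply_def)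

lemma einstein_apply_sum:
  "einstein_apply P Q M (sum f T) = (\<Sum>t\<in>T. einstein_apply P Q M (f t))"
  by (rule ext)
    (simp add: einstein_apply_def sum_tensor_apply sum_distrib_left sum.swap[of _ T])

lemma einstein_apply_sum_left:
  "einstein_apply P Q (sum f T) X = (\<Sum>t\<in>T. einstein_apply P Q (f t) X)"
  by (rule ext)
    (simp add: einstein_apply_def sum_tensor_apply sum_distrib_right sum.swap[of _ T])

section \<open>U-transposes and powers\<close>

lemma u_transpose_prod:
  assumes "length P = length Q" "length Q = length S"
  shows "u_transpose P S (einstein_prod P Q S M L)
    = einstein_prod S Q P (u_transpose Q S L) (u_transpose P Q M)"
  by (rule paired_tensor_eqI[OF _ u_transpose_mem_tensors einstein_prod_mem_tensors])
    (use assms in \<open>simp_all add: einstein_prod_splice u_transpose_splice mult.commute\<close>)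

lemma u_transpose_u_transpose:
  assumes "length P = length Q" "M \<in> tensors (splice P Q)"
  shows "u_transpose Q P (u_transpose P Q M) = M"
  by (rule paired_tensor_eqI[OF assms(1) u_transpose_mem_tensors assms(2)])
    (use assms in \<open>simp add: u_transpose_splice\<close>)

lemma u_transpose_identity: "u_transpose J J (identity_tensor J) = identity_tensor J"
  by (rule paired_tensor_eqI[of J J, OF _ u_transpose_mem_tensors])
    (auto simp: u_transpose_splice identity_tensor_splice identity_tensor_def paired_mem_tensors
      paired_splice)

lemma u_transpose_sum:
  assumes "length P = length Q"
  shows "u_transpose P Q (sum f T) = (\<Sum>t\<in>T. u_transpose P Q (f t))"
  by (rule paired_tensor_eqI[of Q P])
    (use assms in \<open>simp_all add: u_transpose_mem_tensors sum_mem_tensors u_transpose_splice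
      sum_tensor_apply\<close>)

text \<open>Powers are built by multiplying on the left, while transposition reverses the factors.
  This law, applied to the U-transpose of \<open>A\<close>, restores the order in
  \<open>u_transpose_power\<close>.\<close>

lemma einstein_power_Suc_right:
  assumes "A \<in> tensors (splice J J)"
  shows "einstein_prod J J J (einstein_power J A k) A = einstein_power J A (Suc k)"
proof (induction k)
  case 0
  show ?case using assms
    by (simp add: einstein_prod_identity_left einstein_prod_identity_right)
next
  case (Suc k)
  then show ?case by (simp add: einstein_prod_assoc)
qed

lemma u_transpose_power:
  assumes "A \<in> tensors (splice J J)"
  shows "u_transpose J J (einstein_power J A k) = einstein_power J (u_transpose J J A) k"
proof (induction k)
  case 0
  show ?case by (simp add: u_transpose_identity)
next
  case (Suc k)
  have "u_transpose J J (einstein_power J A (Suc k))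
      = einstein_prod J J J (einstein_power J (u_transpose J J A) k) (u_transpose J J A)"
    by (simp add: u_transpose_prod Suc)
  then show ?case
    by (simp only: einstein_power_Suc_right[OF u_transpose_mem_tensors])
qed

section \<open>Inner product and positive definite systems\<close>

definition tensor_inner :: "nat list \<Rightarrow> tensor \<Rightarrow> tensor \<Rightarrow> real" where
  "tensor_inner ds X Y = (\<Sum>i\<in>indices ds. X i * Y i)"

lemma tensor_inner_sum_right:
  "tensor_inner ds X (sum f T) = (\<Sum>t\<in>T. tensor_inner ds X (f t))"
  by (simp add: tensor_inner_def sum_tensor_apply sum_distrib_left sum.swap[of _ T])

lemma tensor_inner_self_nonneg: "tensor_inner ds X X \<ge> 0"
  by (simp add: tensor_inner_def sum_nonneg)

lemma tensor_inner_self_eq_0_iff: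
  assumes "X \<in> tensors ds"
  shows "tensor_inner ds X X = 0 \<longleftrightarrow> X = 0"
proof
  assume "tensor_inner ds X X = 0"
  then have "\<forall>i\<in>indices ds. X i = 0"
    by (simp add: tensor_inner_def sum_nonneg_eq_0_iff)
  then show "X = 0" using assms by (intro tensor_eqI[of _ ds]) simp_all
qed (simp add: tensor_inner_def)

text \<open>The U-transpose is the adjoint for the inner product: write out both sums over indices
  and exchange them.\<close>

lemma tensor_inner_apply:
  assumes "length P = length Q"
  shows "tensor_inner P X (einstein_apply P Q M Y)
    = tensor_inner Q (einstein_apply Q P (u_transpose P Q M) X) Y"
proof -
  have "tensor_inner P X (einstein_apply P Q M Y)
      = (\<Sum>p\<in>indices P. \<Sum>q\<in>indices Q. X p * (M (splice p q) * Y q))"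
    by (simp add: tensor_inner_def einstein_apply_def sum_distrib_left)
  also have "\<dots> = (\<Sum>q\<in>indices Q. \<Sum>p\<in>indices P. X p * (M (splice p q) * Y q))"
    by (rule sum.swap)
  also have "\<dots> = tensor_inner Q (einstein_apply Q P (u_transpose P Q M) X) Y"
    using assms by (simp add: tensor_inner_def einstein_apply_def u_transpose_splice
        sum_distrib_left sum_distrib_right ac_simps)
  finally show ?thesis .
qed

lemma u_positive_definite_iff:
  "u_positive_definite J W \<longleftrightarrow>
    (\<forall>X\<in>tensors J. X \<noteq> 0 \<longrightarrow> tensor_inner J X (einstein_apply J J W X) > 0)"
  by (simp add: u_positive_definite_def tensor_inner_def einstein_apply_def sum_distrib_left
      mult.assoc)

text \<open>Induction on the index set, eliminating one unknown by passing to the Schur complement.\<close>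

lemma positive_definite_solvable:
  fixes M :: "'a \<Rightarrow> 'a \<Rightarrow> real"
  assumes "finite I"
    and "\<And>x. \<exists>i\<in>I. x i \<noteq> 0 \<Longrightarrow> (\<Sum>i\<in>I. x i * (\<Sum>j\<in>I. M i j * x j)) > 0"
  shows "\<exists>x. \<forall>i\<in>I. (\<Sum>j\<in>I. M i j * x j) = b i"
  using assms
proof (induction I arbitrary: M b rule: finite_induct)
  case empty
  show ?case by simp
next
  case (insert a I)
  note pos = insert.prems
  \<comment> \<open>Testing the form on the unit vector at \<open>a\<close> shows that the pivot is
    positive, hence a legitimate divisor.\<close>
  have "0 < (\<Sum>i\<in>insert a I. (if i = a then 1 else 0) *
      (\<Sum>j\<in>insert a I. M i j * (if j = a then 1 else 0)))"
    by (rule pos) simp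
  also have "\<dots> = M a a"
    using insert.hyps by (simp add: if_distrib[of "\<lambda>x. x * _"] if_distrib[of "\<lambda>x. _ * x"]
        del: sum.insert cong: if_cong)
  finally have a: "M a a > 0" .
  define S where "S i j = M i j - M i a * M a j / M a a" for i j
  have S_sum: "(\<Sum>j\<in>I. S i j * x j)
      = (\<Sum>j\<in>I. M i j * x j) - M i a / M a a * (\<Sum>j\<in>I. M a j * x j)" for i x
    by (simp add: S_def left_diff_distrib sum_subtractf sum_distrib_left mult.assoc)
  \<comment> \<open>The new value at \<open>a\<close> is the one that makes row \<open>a\<close> of
    the system equal to \<open>c\<close>. Substituting it into any row \<open>i\<close> leaves the
    Schur complement \<open>S\<close> plus a constant; row \<open>a\<close> of \<open>S\<close> is
    zero by \<open>S_a\<close>.\<close>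
  have lift: "(\<Sum>j\<in>insert a I. M i j * (x(a := (c - (\<Sum>j\<in>I. M a j * x j)) / M a a)) j)
      = (\<Sum>j\<in>I. S i j * x j) + M i a * c / M a a" for i x c
  proof -
    have "(\<Sum>j\<in>I. M i j * (x(a := v)) j) = (\<Sum>j\<in>I. M i j * x j)" for v
      using insert.hyps by (intro sum.cong) auto
    then show ?thesis
      using insert.hyps by (simp add: S_sum diff_divide_distrib right_diff_distrib)
  qed
  have S_a: "(\<Sum>j\<in>I. S a j * x j) = 0" for x
    using a by (simp add: S_def)
  have "\<exists>x. \<forall>i\<in>I. (\<Sum>j\<in>I. S i j * x j) = b i - M i a * b a / M a a"
  proof (rule insert.IH)
    fix x :: "'a \<Rightarrow> real"
    assume x: "\<exists>i\<in>I. x i \<noteq> 0"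
    \<comment> \<open>With \<open>c = 0\<close>, row \<open>a\<close> of \<open>M\<close> applied to
      \<open>y\<close> vanishes, so the form of \<open>M\<close> at \<open>y\<close> equals the form
      of \<open>S\<close> at \<open>x\<close>. Thus \<open>S\<close> inherits positivity on
      \<open>I\<close>, as \<open>y\<close> agrees with \<open>x\<close> there and is
      nonzero.\<close>
    define y where "y = x(a := (0 - (\<Sum>j\<in>I. M a j * x j)) / M a a)"
    have "0 < (\<Sum>i\<in>insert a I. y i * (\<Sum>j\<in>insert a I. M i j * y j))"
      using x insert.hyps by (intro pos) (auto simp: y_def)
    also have "\<dots> = (\<Sum>i\<in>insert a I. y i * (\<Sum>j\<in>I. S i j * x j))"
      by (simp only: y_def lift) simp
    also have "\<dots> = (\<Sum>i\<in>I. y i * (\<Sum>j\<in>I. S i j * x j))"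
      using insert.hyps by (simp add: S_a)
    also have "\<dots> = (\<Sum>i\<in>I. x i * (\<Sum>j\<in>I. S i j * x j))"
      using insert.hyps by (intro sum.cong) (auto simp: y_def)
    finally show "(\<Sum>i\<in>I. x i * (\<Sum>j\<in>I. S i j * x j)) > 0" .
  qed
  then obtain x where x: "\<forall>i\<in>I. (\<Sum>j\<in>I. S i j * x j) = b i - M i a * b a / M a a" ..
  \<comment> \<open>Now \<open>c = b a\<close>: row \<open>a\<close> gives \<open>b a\<close>, and
    in the other rows the constant from \<open>lift\<close> cancels the correction subtracted from
    \<open>b i\<close>.\<close>
  define y where "y = x(a := (b a - (\<Sum>j\<in>I. M a j * x j)) / M a a)"
  have "(\<Sum>j\<in>insert a I. M i j * y j) = b i" if "i \<in> insert a I" for i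
    unfolding y_def lift using that x a S_a by auto
  then show ?case by blast
qed

lemma u_positive_definite_solvable:
  assumes "u_positive_definite J W" "D \<in> tensors J"
  obtains Y where "Y \<in> tensors J" "einstein_apply J J W Y = D"
proof -
  have "(\<Sum>i\<in>indices J. x i * (\<Sum>j\<in>indices J. W (splice i j) * x j)) > 0"
    if x: "\<exists>i\<in>indices J. x i \<noteq> 0" for x
  proof -
    \<comment> \<open>The coordinates form an arbitrary function; extending by 0 outside the index
      set yields a tensor without changing any of the sums. The solution \<open>y\<close> is treated
      alike below.\<close>
    define X where "X = (\<lambda>i. if i \<in> indices J then x i else 0)"
    have "X \<in> tensors J" "X \<noteq> 0" using x by (auto simp: X_def tensors_def fun_eq_iff)
    then have "tensor_inner J X (einstein_apply J J W X) > 0"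
      using assms(1) by (simp add: u_positive_definite_iff)
    then show ?thesis by (simp add: tensor_inner_def einstein_apply_def X_def cong: sum.cong)
  qed
  from positive_definite_solvable[OF finite_indices this, of D]
  obtain y where y: "\<forall>i\<in>indices J. (\<Sum>j\<in>indices J. W (splice i j) * y j) = D i"
    by blast
  define Y where "Y = (\<lambda>i. if i \<in> indices J then y i else 0)"
  have "Y \<in> tensors J" by (simp add: Y_def tensors_def)
  moreover have "einstein_apply J J W Y = D"
    using y by (intro tensor_eqI[OF einstein_apply_mem_tensors assms(2)])
      (simp add: einstein_apply_def Y_def cong: sum.cong)
  ultimately show thesis by (rule that)
qed

section \<open>Trajectories and the Gramian\<close>

text \<open>The tensor \<open>A^k * B\<close> is the response of the state to a single input,
  \<open>k + 1\<close> steps after that input is applied.\<close>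

definition input_tensor :: "nat list \<Rightarrow> nat list \<Rightarrow> tensor \<Rightarrow> tensor \<Rightarrow> nat \<Rightarrow> tensor" where
  "input_tensor J K A B k = einstein_prod J J K (einstein_power J A k) B"

lemma input_tensor_mem_tensors: "input_tensor J K A B k \<in> tensors (splice J K)"
  by (simp add: input_tensor_def einstein_prod_mem_tensors)

lemma input_tensor_0:
  assumes "length J = length K" "B \<in> tensors (splice J K)"
  shows "input_tensor J K A B 0 = B"
  using assms by (simp add: input_tensor_def einstein_prod_identity_left)

lemma input_tensor_Suc:
  assumes "length J = length K"
  shows "input_tensor J K A B (Suc k) = einstein_prod J J K A (input_tensor J K A B k)"
  using assms by (simp add: input_tensor_def einstein_prod_assoc)

text \<open>The discrete variation of constants formula. Applying \<open>A\<close> once more raises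
  every exponent by one, and the newest input enters with exponent 0.\<close>

lemma trajectory_formula:
  fixes X U :: "int \<Rightarrow> tensor"
  assumes len: "length J = length K" and B: "B \<in> tensors (splice J K)"
    and X0: "X t0 \<in> tensors J" and "t0 \<le> t1"
    and step: "\<And>t. t \<in> {t0..<t1} \<Longrightarrow>
      X (t + 1) = einstein_apply J J A (X t) + einstein_apply J K B (U t)"
  shows "X t1 = einstein_apply J J (einstein_power J A (nat (t1 - t0))) (X t0)
    + (\<Sum>t\<in>{t0..t1 - 1}. einstein_apply J K (input_tensor J K A B (nat (t1 - t - 1))) (U t))"
  using \<open>t0 \<le> t1\<close> step
proof (induction t1 rule: int_ge_induct)
  case base
  \<comment> \<open>The sum over \<open>{t0..t0 - 1}\<close> is empty, and the identity tensor fixes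
    \<open>X t0\<close> because it is a tensor of the right dimensions.\<close>
  show ?case using X0 by (simp add: einstein_apply_identity)
next
  case (step s)
  have IH: "X s = einstein_apply J J (einstein_power J A (nat (s - t0))) (X t0)
    + (\<Sum>t\<in>{t0..s - 1}. einstein_apply J K (input_tensor J K A B (nat (s - t - 1))) (U t))"
    using step.prems by (intro step.IH) simp
  have power: "einstein_power J A (nat (s + 1 - t0))
      = einstein_prod J J J A (einstein_power J A (nat (s - t0)))"
  proof -
    have "nat (s + 1 - t0) = Suc (nat (s - t0))" using step.hyps by simp
    then show ?thesis by simp
  qed
  \<comment> \<open>For \<open>t \<le> s - 1\<close> the difference \<open>s - t - 1\<close> is
    nonnegative, so truncation by \<open>nat\<close> is harmless and the exponent really grows by
    one.\<close>
  have input: "input_tensor J K A B (nat (s - t))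
      = einstein_prod J J K A (input_tensor J K A B (nat (s - t - 1)))"
    if "t \<in> {t0..s - 1}" for t
    using that by (simp add: Suc_nat_eq_nat_zadd1 flip: input_tensor_Suc[OF len])
  have ins: "{t0..s} = insert s {t0..s - 1}" using step.hyps by auto
  have "X (s + 1) = einstein_apply J J A (X s) + einstein_apply J K B (U s)"
    using step.hyps by (intro step.prems) simp
  also have "\<dots> = einstein_apply J J (einstein_power J A (nat (s + 1 - t0))) (X t0)
    + ((\<Sum>t\<in>{t0..s - 1}. einstein_apply J K (input_tensor J K A B (nat (s - t))) (U t))
      + einstein_apply J K (input_tensor J K A B 0) (U s))"
    by (simp add: IH power input einstein_apply_add einstein_apply_sum einstein_apply_prod len
        input_tensor_0[OF len B] add.assoc)
  also have "\<dots> = einstein_apply J J (einstein_power J A (nat (s + 1 - t0))) (X t0)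
    + (\<Sum>t\<in>{t0..s + 1 - 1}.
        einstein_apply J K (input_tensor J K A B (nat (s + 1 - t - 1))) (U t))"
    by (simp add: ins add.commute)
  finally show ?case .
qed

text \<open>Since \<open>(A^T)^k\<close> is the U-transpose of \<open>A^k\<close>, the last two
  factors \<open>B^T * (A^T)^k\<close> of each summand combine to the U-transpose of
  \<open>A^k * B\<close>.\<close>

lemma reachability_gramian_eq:
  assumes "length J = length K" "A \<in> tensors (splice J J)"
  shows "reachability_gramian J K A B t0 t1 = (\<Sum>t\<in>{t0..t1 - 1}.
    einstein_prod J K J (input_tensor J K A B (nat (t1 - t - 1)))
      (u_transpose J K (input_tensor J K A B (nat (t1 - t - 1)))))"
  using assms
  by (simp add: reachability_gramian_def input_tensor_def u_transpose_prod u_transpose_power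
      einstein_prod_assoc)

lemma reachability_gramian_apply:
  assumes "length J = length K" "A \<in> tensors (splice J J)"
  shows "einstein_apply J J (reachability_gramian J K A B t0 t1) X = (\<Sum>t\<in>{t0..t1 - 1}.
    einstein_apply J K (input_tensor J K A B (nat (t1 - t - 1)))
      (einstein_apply K J (u_transpose J K (input_tensor J K A B (nat (t1 - t - 1)))) X))"
  using assms by (simp add: reachability_gramian_eq einstein_apply_sum_left einstein_apply_prod)

text \<open>Each summand is a tensor times its own U-transpose; transposition swaps the two factors
  and is an involution.\<close>

lemma weakly_symmetric_reachability_gramian:
  assumes "length J = length K" "A \<in> tensors (splice J J)"
  shows "weakly_symmetric J (reachability_gramian J K A B t0 t1)"
  using assms
  by (simp add: weakly_symmetric_def reachability_gramian_eq u_transpose_sum u_transpose_prod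
      u_transpose_u_transpose input_tensor_mem_tensors)

section \<open>Equivalence of reachability and U-positive definiteness\<close>

lemma reachable_imp_positive_definite:
  assumes len: "length J = length K"
    and A: "A \<in> tensors (splice J J)" and B: "B \<in> tensors (splice J K)"
    and "t0 \<le> t1" and reach: "reachable J K A B t0 t1"
  shows "u_positive_definite J (reachability_gramian J K A B t0 t1)"
  unfolding u_positive_definite_iff
proof (intro ballI impI)
  let ?C = "\<lambda>t. input_tensor J K A B (nat (t1 - t - 1))"
  let ?V = "\<lambda>X t. einstein_apply K J (u_transpose J K (?C t)) X"
  fix X assume X: "X \<in> tensors J" "X \<noteq> 0"
  \<comment> \<open>By adjointness each \<open>?C t\<close> moves to the other side of the inner
    product, leaving a sum of squared norms.\<close>
  have form: "tensor_inner J X (einstein_apply J J (reachability_gramian J K A B t0 t1) X)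
      = (\<Sum>t\<in>{t0..t1 - 1}. tensor_inner K (?V X t) (?V X t))"
    using len A by (simp add: reachability_gramian_apply tensor_inner_sum_right tensor_inner_apply)
  show "tensor_inner J X (einstein_apply J J (reachability_gramian J K A B t0 t1) X) > 0"
  proof (rule ccontr)
    assume "\<not> ?thesis"
    moreover have "(\<Sum>t\<in>{t0..t1 - 1}. tensor_inner K (?V X t) (?V X t)) \<ge> 0"
      by (intro sum_nonneg tensor_inner_self_nonneg)
    ultimately have "(\<Sum>t\<in>{t0..t1 - 1}. tensor_inner K (?V X t) (?V X t)) = 0"
      using form by linarith
    then have "tensor_inner K (?V X t) (?V X t) = 0" if "t \<in> {t0..t1 - 1}" for t
      using that by (simp add: sum_nonneg_eq_0_iff tensor_inner_self_nonneg)
    then have V: "?V X t = 0" if "t \<in> {t0..t1 - 1}" for t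
      using that by (simp add: tensor_inner_self_eq_0_iff[OF einstein_apply_mem_tensors])
    \<comment> \<open>Starting from 0 removes the free evolution, so \<open>X\<close> becomes a sum
      of input responses alone.\<close>
    obtain U Z :: "int \<Rightarrow> tensor" where Z: "Z t0 = 0" "Z t1 = X"
      "\<And>t. t \<in> {t0..<t1} \<Longrightarrow>
        Z (t + 1) = einstein_apply J J A (Z t) + einstein_apply J K B (U t)"
      using reach X(1) unfolding reachable_def by (metis zero_mem_tensors)
    have "X = (\<Sum>t\<in>{t0..t1 - 1}. einstein_apply J K (?C t) (U t))"
      using trajectory_formula[OF len B, of Z t0 t1 A U] Z \<open>t0 \<le> t1\<close> by simp
    then have "tensor_inner J X X
        = tensor_inner J X (\<Sum>t\<in>{t0..t1 - 1}. einstein_apply J K (?C t) (U t))"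
      by (rule arg_cong)
    \<comment> \<open>Moving \<open>?C t\<close> across the inner product produces its U-transpose
      applied to \<open>X\<close>, which vanishes by \<open>V\<close>.\<close>
    also have "\<dots> = (\<Sum>t\<in>{t0..t1 - 1}. tensor_inner K (?V X t) (U t))"
      using len by (simp add: tensor_inner_sum_right tensor_inner_apply)
    also have "\<dots> = 0" using V by (intro sum.neutral) (simp add: tensor_inner_def)
    finally show False using X by (simp add: tensor_inner_self_eq_0_iff)
  qed
qed

lemma positive_definite_imp_reachable:
  assumes len: "length J = length K"
    and A: "A \<in> tensors (splice J J)" and B: "B \<in> tensors (splice J K)"
    and "t0 \<le> t1" and pd: "u_positive_definite J (reachability_gramian J K A B t0 t1)"
  shows "reachable J K A B t0 t1"
  unfolding reachable_def
proof (intro ballI)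
  let ?C = "\<lambda>t. input_tensor J K A B (nat (t1 - t - 1))"
  fix X0 X1 assume X: "X0 \<in> tensors J" "X1 \<in> tensors J"
  \<comment> \<open>The target minus the free evolution of \<open>X0\<close>: exactly what the
    inputs must contribute.\<close>
  define D where "D = X1 - einstein_apply J J (einstein_power J A (nat (t1 - t0))) X0"
  have "D \<in> tensors J"
    unfolding D_def using X(2) by (intro diff_mem_tensors einstein_apply_mem_tensors)
  with pd obtain Y where Y: "einstein_apply J J (reachability_gramian J K A B t0 t1) Y = D"
    by (rule u_positive_definite_solvable)
  define U where "U t = einstein_apply K J (u_transpose J K (?C t)) Y" for t
  \<comment> \<open>The trajectory is built by recursion on the number \<open>n\<close> of elapsed
    steps, the input being read at time \<open>t0 + n\<close>. Through \<open>nat\<close>, times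
    before \<open>t0\<close> get the default \<open>X0\<close>.\<close>
  define Z where "Z = rec_nat X0
    (\<lambda>n x. einstein_apply J J A x + einstein_apply J K B (U (t0 + int n)))"
  define X where "X t = Z (nat (t - t0))" for t
  have X_t0: "X t0 = X0" by (simp add: X_def Z_def)
  have step: "X (t + 1) = einstein_apply J J A (X t) + einstein_apply J K B (U t)"
    if "t \<in> {t0..<t1}" for t
  proof -
    have "nat (t + 1 - t0) = Suc (nat (t - t0))" using that by auto
    then show ?thesis using that by (simp add: X_def Z_def)
  qed
  have "X t1 = einstein_apply J J (einstein_power J A (nat (t1 - t0))) X0
      + (\<Sum>t\<in>{t0..t1 - 1}. einstein_apply J K (?C t) (U t))"
    using trajectory_formula[where X = X and U = U, OF len B _ \<open>t0 \<le> t1\<close> step] X X_t0 by simp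
  \<comment> \<open>For this choice of \<open>U\<close> the summands are those of the Gramian
    applied to \<open>Y\<close>, and \<open>Y\<close> was chosen to solve that system.\<close>
  also have "(\<Sum>t\<in>{t0..t1 - 1}. einstein_apply J K (?C t) (U t)) = D"
    using Y by (simp add: reachability_gramian_apply[OF len A] U_def)
  finally have "X t1 = X1" by (simp add: D_def)
  moreover have "\<forall>t\<in>{t0..<t1}. U t \<in> tensors K"
    by (simp add: U_def einstein_apply_mem_tensors)
  ultimately show "\<exists>U X. (\<forall>t\<in>{t0..<t1}. U t \<in> tensors K) \<and> X t0 = X0 \<and>
      (\<forall>t\<in>{t0..<t1}. X (t + 1) = einstein_apply J J A (X t) + einstein_apply J K B (U t)) \<and>
      X t1 = X1"
    using X_t0 step by blast
qed

theorem theorem5p6: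
  fixes N :: nat and J K :: "nat list" and A B :: tensor and t0 t1 :: int
  assumes "length J = N" and "length K = N"
    and "A \<in> tensors (splice J J)" and "B \<in> tensors (splice J K)"
    and "t0 < t1"
  shows "reachability_gramian J K A B t0 t1 \<in> tensors (splice J J)
    \<and> weakly_symmetric J (reachability_gramian J K A B t0 t1)
    \<and> (reachable J K A B t0 t1 \<longleftrightarrow>
        u_positive_definite J (reachability_gramian J K A B t0 t1))"
proof (intro conjI iffI)
  have len: "length J = length K" and le: "t0 \<le> t1" using assms by simp_all
  show "reachability_gramian J K A B t0 t1 \<in> tensors (splice J J)"
    unfolding reachability_gramian_def by (intro sum_mem_tensors einstein_prod_mem_tensors)
  show "weakly_symmetric J (reachability_gramian J K A B t0 t1)"
    using len assms(3) by (rule weakly_symmetric_reachability_gramian)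
  show "u_positive_definite J (reachability_gramian J K A B t0 t1)"
    if "reachable J K A B t0 t1"
    using len assms(3,4) le that by (rule reachable_imp_positive_definite)
  show "reachable J K A B t0 t1"
    if "u_positive_definite J (reachability_gramian J K A B t0 t1)"
    using len assms(3,4) le that by (rule positive_definite_imp_reachable)
qed

end
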